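(* Let $g$ be a positive integer, and let $\lambda$ and $\lambda'$ be partitions of positive integers such that $\lambda\not\le\lambda'$. Then there exists a graph $G$ of girth at least $g$ which is $\lambda$-choosable but not $\lambda'$-choosable.
   Context: Graphs are finite and simple. The girth of a graph is the smallest length of its cycles (a graph with no cycles has infinite girth, so its girth is at least $g$ for every $g$). A partition of a positive integer $k$ is a finite multiset $\lambda=\{k_1,\dots,k_q\}$ of positive integers (called the parts of $\lambda$) with $k_1+\dots+k_q=k$. A $k$-assignment of a graph $G$ is a mapping $L$ assigning to each vertex $v$ a set $L(v)$ of colours with $|L(v)|=k$. $G$ is $L$-colourable if there is a proper colouring $f$ of $G$ (adjacent vertices receive different colours) with $f(v)\in L(v)$ for every vertex $v$. For a partition $\lambda=\{k_1,\dots,k_q\}$ of $k$, a $\lambda$-assignment of $G$ is a $k$-assignment $L$ of $G$ such that the colour set $\bigcup_{v\in V(G)}L(v)$ can be partitioned into (pairwise disjoint) sets $C_1,\dots,C_q$ with $|L(v)\cap C_i|=k_i$ for every vertex $v$ and every $1\le i\le q$. $G$ is $\lambda$-choosable if $G$ is $L$-colourable for every $\lambda$-assignment $L$ of $G$. If $\mu,\nu$ are partitions of the same integer, $\nu$ is a refinement of $\mu$ if $\nu$ is obtained from $\mu$ by replacing some (possibly none) of the parts of $\mu$ by partitions of these parts. Let $\lambda=\{k_1,\dots,k_q\}$ be a partition of $k$ and $\lambda'$ a partition of $k'$. Write $\lambda\le\lambda'$ if $k'\ge k$ and there is a partition $\lambda''=\{k_1'',\dots,k_q''\}$ of $k'$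 with $k_i''\ge k_i$ for $i=1,\dots,q$ such that $\lambda'$ is a refinement of $\lambda''$. Write $\lambda\not\le\lambda'$ if $\lambda\le\lambda'$ does not hold (in particular whenever $k'<k$). *)

theory Defs
  imports "HOL-Library.Multiset" "HOL-Library.Extended_Nat" "HOL-Library.Disjoint_Sets"
begin

section \<open>Finite simple graphs and girth\<close>

definition simple_graph :: "'a set \<Rightarrow> 'a set set \<Rightarrow> bool" where
  "simple_graph V E \<longleftrightarrow> finite V \<and> (\<forall>e\<in>E. e \<subseteq> V \<and> card e = 2)"

text \<open>A cycle is given by the list of its vertices in cyclic order; its length as a cycle is the
  length of that list.\<close>

definition is_cycle :: "'a set \<Rightarrow> 'a set set \<Rightarrow> 'a list \<Rightarrow> bool" where
  "is_cycle V E c \<longleftrightarrow> 3 \<le> length c \<and> distinct c \<and> set c \<subseteq> V \<and>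
     (\<forall>i < length c. {c ! i, c ! (Suc i mod length c)} \<in> E)"

text \<open>An infimum over the empty set is \<open>\<infinity>\<close>, so acyclic graphs have infinite girth.\<close>

definition girth :: "'a set \<Rightarrow> 'a set set \<Rightarrow> enat" where
  "girth V E = (INF c \<in> {c. is_cycle V E c}. enat (length c))"


section \<open>Partitions of positive integers\<close>

definition partition_of :: "nat multiset \<Rightarrow> nat \<Rightarrow> bool" where
  "partition_of p k \<longleftrightarrow> 0 < k \<and> 0 \<notin># p \<and> \<Sum>\<^sub># p = k"

text \<open>\<open>rel_mset R\<close> relates two multisets whose elements can be matched one to one along \<open>R\<close>.
  Below, \<open>P\<close> holds one partition for each part of \<open>m\<close>; an unreplaced part \<open>a\<close> corresponds to the
  trivial partition \<open>{#a#}\<close>.\<close>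

definition refinement :: "nat multiset \<Rightarrow> nat multiset \<Rightarrow> bool" where
  "refinement n m \<longleftrightarrow> (\<exists>P. rel_mset partition_of P m \<and> n = \<Sum>\<^sub># P)"

definition partition_le :: "nat multiset \<Rightarrow> nat multiset \<Rightarrow> bool" where
  "partition_le l l' \<longleftrightarrow> \<Sum>\<^sub># l \<le> \<Sum>\<^sub># l' \<and>
     (\<exists>l''. partition_of l'' (\<Sum>\<^sub># l') \<and> rel_mset (\<le>) l l'' \<and> refinement l' l'')"


section \<open>List colourings\<close>

definition k_assignment :: "'a set \<Rightarrow> nat \<Rightarrow> ('a \<Rightarrow> 'c set) \<Rightarrow> bool" where
  "k_assignment V k L \<longleftrightarrow> (\<forall>v\<in>V. finite (L v) \<and> card (L v) = k)"

definition list_colourable :: "'a set \<Rightarrow> 'a set set \<Rightarrow> ('a \<Rightarrow> 'c set) \<Rightarrow> bool" where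
  "list_colourable V E L \<longleftrightarrow>
     (\<exists>f. (\<forall>v\<in>V. f v \<in> L v) \<and> (\<forall>u v. {u, v} \<in> E \<longrightarrow> f u \<noteq> f v))"

text \<open>The list \<open>ks\<close> is an enumeration \<open>k\<^sub>1, \<dots>, k\<^sub>q\<close> of the parts of \<open>l\<close>.\<close>

definition partition_assignment ::
    "'a set \<Rightarrow> nat multiset \<Rightarrow> ('a \<Rightarrow> 'c set) \<Rightarrow> bool" where
  "partition_assignment V l L \<longleftrightarrow> k_assignment V (\<Sum>\<^sub># l) L \<and>
     (\<exists>ks C. mset ks = l \<and>
        disjoint_family_on C {..<length ks} \<and>
        (\<Union>i<length ks. C i) = (\<Union>v\<in>V. L v) \<and>
        (\<forall>v\<in>V. \<forall>i<length ks. card (L v \<inter> C i) = ks ! i))"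

text \<open>Colours are natural numbers. For finite graphs this is no restriction, since only finitely many
  colours occur; see \<open>choosable_any_colours\<close>.\<close>

definition choosable :: "'a set \<Rightarrow> 'a set set \<Rightarrow> nat multiset \<Rightarrow> bool" where
  "choosable V E l \<longleftrightarrow>
     (\<forall>L :: 'a \<Rightarrow> nat set. partition_assignment V l L \<longrightarrow> list_colourable V E L)"

lemma choosable_any_colours:
  fixes L :: "'a \<Rightarrow> 'c set"
  assumes G: "simple_graph V E" and ch: "choosable V E l" and L: "partition_assignment V l L"
  shows "list_colourable V E L"
proof -
  define U where "U = (\<Union>v\<in>V. L v)"
  have fin: "finite U"
    using G L unfolding U_def simple_graph_def partition_assignment_def k_assignment_def by auto
  obtain h :: "'c \<Rightarrow> nat" where h: "inj_on h U"
    using finite_imp_inj_to_nat_seg[OF fin] by (elim exE conjE)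
  have sub: "L v \<subseteq> U" if "v \<in> V" for v
    using that by (auto simp: U_def)
  have ka: "k_assignment V (\<Sum>\<^sub># l) L"
    using L unfolding partition_assignment_def by (rule conjunct1)
  obtain ks C where ks: "mset ks = l" and dis: "disjoint_family_on C {..<length ks}"
    and un: "(\<Union>i<length ks. C i) = U"
    and cd: "\<forall>v\<in>V. \<forall>i<length ks. card (L v \<inter> C i) = ks ! i"
    using L unfolding partition_assignment_def U_def by (elim exE conjE)
  have subC: "C i \<subseteq> U" if "i < length ks" for i
    using that un by blast
  have "k_assignment V (\<Sum>\<^sub># l) (\<lambda>v. h ` L v)"
    unfolding k_assignment_def
  proof
    fix v assume v: "v \<in> V"
    have "finite (L v)" "card (L v) = \<Sum>\<^sub># l"
      using ka v unfolding k_assignment_def by blast+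
    moreover have "card (h ` L v) = card (L v)"
      by (rule card_image) (rule inj_on_subset[OF h sub[OF v]])
    ultimately show "finite (h ` L v) \<and> card (h ` L v) = \<Sum>\<^sub># l"
      by simp
  qed
  moreover have "disjoint_family_on (\<lambda>i. h ` C i) {..<length ks}"
    unfolding disjoint_family_on_def
  proof (intro ballI impI)
    fix i j assume ij: "i \<in> {..<length ks}" "j \<in> {..<length ks}" "i \<noteq> j"
    then have "C i \<inter> C j = {}"
      using dis by (auto simp: disjoint_family_on_def)
    then show "h ` C i \<inter> h ` C j = {}"
      using inj_on_image_Int[OF h subC subC, of i j] ij by auto
  qed
  moreover have "(\<Union>i<length ks. h ` C i) = (\<Union>v\<in>V. h ` L v)"
    using un unfolding U_def by (metis image_UN)
  moreover have "card (h ` L v \<inter> h ` C i) = ks ! i" if "v \<in> V" "i < length ks" for v i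
  proof -
    have "h ` L v \<inter> h ` C i = h ` (L v \<inter> C i)"
      using inj_on_image_Int[OF h sub subC] that by auto
    moreover have "inj_on h (L v \<inter> C i)"
      using h sub[OF that(1)] by (blast intro: inj_on_subset)
    ultimately show ?thesis
      using cd that by (simp add: card_image)
  qed
  ultimately have "partition_assignment V l (\<lambda>v. h ` L v)"
    unfolding partition_assignment_def using ks
    by (intro conjI exI[of _ ks] exI[of _ "\<lambda>i. h ` C i"] ballI allI impI) simp_all
  then have "list_colourable V E (\<lambda>v. h ` L v)"
    using ch unfolding choosable_def by simp
  then obtain f where f: "\<forall>v\<in>V. f v \<in> h ` L v"
    and p: "\<forall>u v. {u, v} \<in> E \<longrightarrow> f u \<noteq> f v"
    unfolding list_colourable_def by (elim exE conjE)
  have "\<forall>v\<in>V. \<exists>c\<in>L v. h c = f v"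
    using f by force
  then obtain f' where f': "\<And>v. v \<in> V \<Longrightarrow> f' v \<in> L v \<and> h (f' v) = f v"
    by metis
  have "f' u \<noteq> f' v" if "{u, v} \<in> E" for u v
  proof -
    have "u \<in> V" "v \<in> V"
      using that G by (auto simp: simple_graph_def)
    then show ?thesis
      using f' p that by metis
  qed
  then show ?thesis
    unfolding list_colourable_def using f' by blast
qed

end

theory Submission
  imports Defs "HOL-Library.Nat_Bijection" "HOL-Combinatorics.List_Permutation"
begin

text \<open>
  Write \<open>l\<close> as \<open>n\<^sub>1, \<dots>, n\<^sub>q\<close> and \<open>l'\<close> as \<open>m\<^sub>1, \<dots>, m\<^sub>p\<close>. That \<open>l \<le> l'\<close> fails means: however the indices
  \<open>1, \<dots>, p\<close> are assigned to the types \<open>1, \<dots>, q\<close>, some type \<open>i\<close> receives parts \<open>m\<^sub>j\<close> of sum (its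
  load) less than \<open>n\<^sub>i\<close>. The vertices of the graph are given types, and the vertices of type \<open>i\<close>
  induce a graph that can be coloured from any lists of size \<open>n\<^sub>i\<close>. Such a graph is \<open>l\<close>-choosable,
  since the vertices of type \<open>i\<close> may be coloured from the \<open>i\<close>-th colour class
  (\<open>choosable_if_typed_choosable\<close>).

  To defeat \<open>l'\<close>, think of a game in which Builder presents vertices with lists and edges to earlier
  vertices, and Painter colours each at once. Builder assigns colour classes to types, beginning
  with none assigned. As long as some class is unassigned, Builder chooses a type \<open>i\<close> of load below
  \<open>n\<^sub>i\<close> and presents many vertices of type \<open>i\<close>, each joined, for every assigned class \<open>j\<close>, to \<open>m\<^sub>j\<close>
  earlier vertices whose colours are the colours of class \<open>j\<close> in its list. So Painter
  uses unassigned classes, one of them, say \<open>j\<close>, many times, and Builder assigns \<open>j\<close> to the type \<open>i\<close>.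
  When all classes are assigned, there still is a type \<open>i\<close> of load below \<open>n\<^sub>i\<close>, and a vertex of type
  \<open>i\<close> can be presented whose whole list is blocked. A vertex of type \<open>i\<close> is only ever joined to as
  many earlier vertices of its own type as the load of \<open>i\<close> says, that is, to fewer than \<open>n\<^sub>i\<close>, so
  the colouring within each type is possible greedily.

  The graph has to anticipate all replies of Painter without having short cycles. This is done
  backwards (\<open>gadget_step\<close>): the vertices presented at one stage are the vertices of a uniform hypergraph of
  large girth and large chromatic number. A monochromatic edge of it tells which reply was
  given throughout, and on every edge hang copies of the gadgets for all possible
  replies. The existence of such hypergraphs (\<open>sparse_unavoidable_hypergraph\<close>) is proved by
  partite amalgamation. One lemma on amalgams, \<open>sparse_glue\<close>, controls the girth in both
  constructions; there, girth is expressed by the absence of short detours around an edge.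
\<close>

section \<open>Sparse hypergraphs and amalgamation\<close>

text \<open>One step of a walk in the hypergraph \<open>F\<close>, where staying put is allowed, so that the \<open>n\<close>-th
  relational power describes walks of length at most \<open>n\<close>.\<close>
definition link :: "'a set set \<Rightarrow> ('a \<times> 'a) set" where
  "link F = {(x, y). x = y \<or> (\<exists>B\<in>F. x \<in> B \<and> y \<in> B)}"

text \<open>A hypergraph has a cycle of length at most \<open>h + 1\<close> (two edges that share two vertices form a
  cycle of length 2) exactly if two distinct vertices of some edge \<open>A\<close> are joined by a walk of length at most
  \<open>h\<close> that avoids \<open>A\<close>. Forbidding such walks is therefore the condition "girth larger than
  \<open>h + 1\<close>". Walks behave better than cycles under projections, because the image of a walk is again
  a walk, and a graph is the special case in which all edges have two elements.\<close>
definition sparse :: "nat \<Rightarrow> 'a set set \<Rightarrow> bool" where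
  "sparse h F \<longleftrightarrow> (\<forall>A\<in>F. \<forall>u\<in>A. \<forall>v\<in>A. (u, v) \<in> link (F - {A}) ^^ h \<longrightarrow> u = v)"

lemma link_refl [simp]: "(x, x) \<in> link F"
  by (simp add: link_def)

lemma linkI: "B \<in> F \<Longrightarrow> x \<in> B \<Longrightarrow> y \<in> B \<Longrightarrow> (x, y) \<in> link F"
  by (auto simp: link_def)

lemma link_relpow_mono:
  assumes "(x, y) \<in> link F ^^ m" "m \<le> n"
  shows "(x, y) \<in> link F ^^ n"
  using assms(2,1)
proof (induction n rule: dec_induct)
  case (step n)
  then show ?case by (auto intro: relcompI)
qed simp

lemma relpow_map:
  assumes "(x, y) \<in> R ^^ n" and "\<And>x y. (x, y) \<in> R \<Longrightarrow> (f x, f y) \<in> S"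
  shows "(f x, f y) \<in> S ^^ n"
  using assms(1)
proof (induction n arbitrary: y)
  case (Suc n)
  then show ?case using assms(2) by (auto intro: relcompI)
qed simp

lemma link_relpow_isolated:
  assumes "(x, y) \<in> link F ^^ n" and "x \<notin> \<Union>F \<or> y \<notin> \<Union>F"
  shows "x = y"
  using assms
proof (induction n arbitrary: y)
  case (Suc n)
  then obtain z where "(x, z) \<in> link F ^^ n" "(z, y) \<in> link F" by auto
  with Suc show ?case unfolding link_def by blast
qed simp

lemma sparse_image:
  assumes sp: "sparse h F" and inj: "inj_on f (\<Union>F)"
  shows "sparse h ((`) f ` F)"
  unfolding sparse_def
proof (intro ballI impI)
  fix A' u v
  assume A': "A' \<in> (`) f ` F" and u: "u \<in> A'" and v: "v \<in> A'"
    and walk: "(u, v) \<in> link ((`) f ` F - {A'}) ^^ h"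
  obtain A where A: "A \<in> F" "A' = f ` A" using A' by auto
  let ?g = "inv_into (\<Union>F) f"
  have gf: "?g (f x) = x" if "x \<in> B" "B \<in> F" for x B
    using that inj by (auto intro: inv_into_f_f)
  have "(?g u, ?g v) \<in> link (F - {A}) ^^ h"
  proof (rule relpow_map[OF walk])
    fix x y assume "(x, y) \<in> link ((`) f ` F - {A'})"
    then consider "x = y" | B where "B \<in> F" "B \<noteq> A" "x \<in> f ` B" "y \<in> f ` B"
      unfolding link_def A(2) by blast
    then show "(?g x, ?g y) \<in> link (F - {A})"
    proof cases
      case (2 B)
      then have "?g x \<in> B" "?g y \<in> B" using gf by auto
      then show ?thesis using 2 by (auto intro!: linkI[of B])
    qed simp
  qed
  moreover have "?g u \<in> A" "?g v \<in> A" "f (?g u) = u" "f (?g v) = v"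
    using u v A gf by auto
  ultimately show "u = v"
    using sp A(1) unfolding sparse_def by metis
qed

text \<open>The amalgamation principle. For each edge \<open>N e\<close> of a sparse hypergraph there is a hypergraph
  \<open>C e\<close> that lives on \<open>N e\<close> and private vertices \<open>W e\<close>, and no edge of \<open>C e\<close> has two vertices in
  \<open>N e\<close>. A short walk that starts and ends in \<open>C e\<close> can leave it only through \<open>N e\<close>; the part outside
  \<open>C e\<close> projects to a walk among the other edges \<open>N f\<close>, hence by sparseness it returns to the vertex of
  \<open>N e\<close> at which it left. Such excursions can be cut out, and a short walk inside \<open>C e\<close> remains. A
  cycle of the amalgam that leaves \<open>C e\<close> must spend one step inside \<open>C e\<close>, which is why the bound
  improves from \<open>h\<close> to \<open>h + 1\<close>.\<close>
lemma sparse_glue: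
  assumes H: "sparse h (N ` I)" and N: "inj_on N I"
    and C: "\<And>e. e \<in> I \<Longrightarrow> sparse (Suc h) (C e)"
    and sub: "\<And>e A. e \<in> I \<Longrightarrow> A \<in> C e \<Longrightarrow> A \<subseteq> N e \<union> W e"
    and one: "\<And>e A x y. e \<in> I \<Longrightarrow> A \<in> C e \<Longrightarrow> x \<in> A \<inter> N e \<Longrightarrow> y \<in> A \<inter> N e \<Longrightarrow> x = y"
    and WN: "\<And>e f. e \<in> I \<Longrightarrow> f \<in> I \<Longrightarrow> W e \<inter> N f = {}"
    and WW: "\<And>e f. e \<in> I \<Longrightarrow> f \<in> I \<Longrightarrow> e \<noteq> f \<Longrightarrow> W e \<inter> W f = {}"
  shows "sparse (Suc h) (\<Union>e\<in>I. C e)"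
  unfolding sparse_def
proof (intro ballI impI)
  fix A u v
  assume A: "A \<in> (\<Union>e\<in>I. C e)" and u: "u \<in> A" and v: "v \<in> A"
    and walk: "(u, v) \<in> link ((\<Union>e\<in>I. C e) - {A}) ^^ Suc h"
  obtain e where e: "e \<in> I" "A \<in> C e" using A by auto
  let ?S = "link (C e - {A})" and ?Q = "link (N ` I - {N e})"
  have baseE: "x = y" if "x \<in> N e" "y \<in> N e" "(x, y) \<in> ?Q ^^ m" "m \<le> h" for x y m
    using H e(1) that link_relpow_mono[OF that(3,4)] unfolding sparse_def by blast
  have copyE: "x = y" if "x \<in> A" "y \<in> A" "(x, y) \<in> ?S ^^ m" "m \<le> Suc h" for x y m
    using C[OF e(1)] e(2) that link_relpow_mono[OF that(3,4)] unfolding sparse_def by blast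
  \<comment> \<open>A walk from \<open>y\<close> to \<open>v\<close> splits at the vertex \<open>x\<close>
      where it first enters \<open>C e\<close>: the part after \<open>x\<close> lies in \<open>C e\<close> up to excursions that have been cut out,
      and the part before \<open>x\<close> projects to the base, where a private vertex of \<open>f\<close> projects to some
      vertex \<open>z\<close> of \<open>N f\<close>.\<close>
  have key: "(y \<in> W e \<longrightarrow> (y, v) \<in> ?S ^^ n) \<and>
      (y \<notin> W e \<longrightarrow> (\<exists>x\<in>N e. \<exists>m m'. m + m' \<le> n \<and> (x, v) \<in> ?S ^^ m' \<and>
        (y \<in> \<Union> (N ` I) \<longrightarrow> (y, x) \<in> ?Q ^^ m) \<and>
        (\<forall>f\<in>I. y \<in> W f \<longrightarrow> (\<exists>z\<in>N f. (z, x) \<in> ?Q ^^ m))))" (is "?K n y")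
    if "(y, v) \<in> link ((\<Union>e\<in>I. C e) - {A}) ^^ n" "n \<le> Suc h" for n y
    using that
  proof (induction n arbitrary: y)
    case 0
    then have yv: "y = v" by simp
    have "v \<in> N e \<union> W e" using v sub e by blast
    then show ?case unfolding yv
      using WN e(1) by (auto intro!: bexI[of _ v] exI[of _ "0::nat"])
  next
    case (Suc n)
    obtain y' where y': "(y, y') \<in> link ((\<Union>e\<in>I. C e) - {A})"
      "(y', v) \<in> link ((\<Union>e\<in>I. C e) - {A}) ^^ n"
      using relpow_Suc_D2[OF Suc.prems(1)] by blast
    have IH: "?K n y'" using Suc.IH[OF y'(2)] Suc.prems(2) by simp
    consider (stay) "y = y'" | (move) f B where "y \<noteq> y'" "f \<in> I" "B \<in> C f" "B \<noteq> A" "y \<in> B" "y' \<in> B"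
      using y'(1) unfolding link_def by blast
    then show ?case
    proof cases
      case stay
      show ?thesis
      proof (intro conjI impI)
        assume "y \<in> W e"
        then show "(y, v) \<in> ?S ^^ Suc n" using IH stay link_relpow_mono[of y v n _ "Suc n"] by auto
      next
        assume "y \<notin> W e"
        then show "\<exists>x\<in>N e. \<exists>m m'. m + m' \<le> Suc n \<and> (x, v) \<in> ?S ^^ m' \<and>
        (y \<in> \<Union> (N ` I) \<longrightarrow> (y, x) \<in> ?Q ^^ m) \<and>
        (\<forall>f\<in>I. y \<in> W f \<longrightarrow> (\<exists>z\<in>N f. (z, x) \<in> ?Q ^^ m))"
          using IH stay le_SucI by meson
      qed
    next
      case (move f B)
      have yB: "y \<in> N f \<union> W f" "y' \<in> N f \<union> W f" using move sub by blast+
      have sole: "f = e" if "x \<in> W e" "x \<in> N f \<union> W f" for x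
        using that WN[OF e(1) move(2)] WW[OF e(1) move(2)] by blast
      show ?thesis
      proof (cases "y \<in> W e")
        case True
        have fe: "f = e" using sole True yB by blast
        then have step: "(y, y') \<in> ?S" using move by (auto intro!: linkI[of B])
        have "(y', v) \<in> ?S ^^ n"
        proof (cases "y' \<in> W e")
          case False
          then have y'N: "y' \<in> N e" using yB fe by blast
          obtain x m m' where x: "x \<in> N e" "m + m' \<le> n" "(x, v) \<in> ?S ^^ m'" "(y', x) \<in> ?Q ^^ m"
            using IH False y'N e(1) by blast
          \<comment> \<open>The excursion that starts here has to come back to the same vertex.\<close>
          have "y' = x" using baseE[OF y'N x(1,4)] x(2) Suc.prems(2) by simp
          then show ?thesis using link_relpow_mono[OF x(3)] x(2) by simp
        qed (use IH in blast)
        then show ?thesis using step True relpow_Suc_I2 by metis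
      next
        case False
        have goal: ?thesis
          if "x \<in> N e" "m + m' \<le> Suc n" "(x, v) \<in> ?S ^^ m'" "y \<in> \<Union> (N ` I) \<Longrightarrow> (y, x) \<in> ?Q ^^ m"
            "\<And>g. g \<in> I \<Longrightarrow> y \<in> W g \<Longrightarrow> (\<exists>z\<in>N g. (z, x) \<in> ?Q ^^ m)" for x m m'
          using that False by blast
        show ?thesis
        proof (cases "y' \<in> W e")
          case True
          have fe: "f = e" using sole True yB by blast
          have yN: "y \<in> N e" using yB fe False by blast
          have step: "(y, y') \<in> ?S" using move fe by (auto intro!: linkI[of B])
          have walk': "(y, v) \<in> ?S ^^ Suc n" using IH True relpow_Suc_I2[OF step] by blast
          have out: "y \<notin> W g" if "g \<in> I" for g using WN[OF that e(1)] yN by blast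
          show ?thesis
          proof (rule goal[OF yN _ walk'])
            show "0 + Suc n \<le> Suc n" by simp
            show "(y, y) \<in> ?Q ^^ 0" by simp
          qed (use out in blast)
        next
          case y'W: False
          obtain x m m' where x: "x \<in> N e" "m + m' \<le> n" "(x, v) \<in> ?S ^^ m'"
              "y' \<in> \<Union> (N ` I) \<longrightarrow> (y', x) \<in> ?Q ^^ m"
              "\<forall>g\<in>I. y' \<in> W g \<longrightarrow> (\<exists>z\<in>N g. (z, x) \<in> ?Q ^^ m)"
            using IH[THEN conjunct2, THEN mp, OF y'W] by (elim bexE exE conjE)
          show ?thesis
          proof (cases "y \<in> N f")
            case True
            then have "y' \<notin> N f" using one[OF move(2,3)] move by blast
            then have y'f: "y' \<in> W f" using yB by blast
            then have "f \<noteq> e" using y'W by blast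
            obtain z where z: "z \<in> N f" "(z, x) \<in> ?Q ^^ m" using x(5)[THEN bspec, THEN mp, OF move(2) y'f] by blast
            have "N f \<noteq> N e" using N move(2) e(1) \<open>f \<noteq> e\<close> by (auto dest: inj_onD)
            then have "(y, z) \<in> ?Q" using True z(1) move(2) by (auto intro!: linkI[of "N f"])
            then have reach: "(y, x) \<in> ?Q ^^ Suc m" using z(2) relpow_Suc_I2 by metis
            have out: "y \<notin> W g" if "g \<in> I" for g using WN[OF that move(2)] True by blast
            show ?thesis
            proof (rule goal[OF x(1) _ x(3) reach])
              show "Suc m + m' \<le> Suc n" using x(2) by simp
            qed (use out in blast)
          next
            case yN: False
            then have yf: "y \<in> W f" using yB by blast
            have only: "g = f" if "g \<in> I" "y \<in> W g" for g
              using WW[OF that(1) move(2)] that yf by blast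
            have "\<exists>z\<in>N f. (z, x) \<in> ?Q ^^ m"
              using x(4) x(5)[THEN bspec, OF move(2)] yB(2) move(2) by blast
            moreover have "y \<notin> \<Union> (N ` I)" using WN[OF move(2)] yf by blast
            ultimately show ?thesis
              by (intro goal[OF x(1) le_SucI[OF x(2)] x(3)]) (use only in blast)+
          qed
        qed
      qed
    qed
  qed
  show "u = v"
  proof (cases "u \<in> W e")
    case True
    then show ?thesis using key[OF walk] copyE[OF u v, of "Suc h"] by blast
  next
    case False
    then have uN: "u \<in> N e" using u sub e by blast
    obtain x m m' where x: "x \<in> N e" "m + m' \<le> Suc h" "(x, v) \<in> ?S ^^ m'" "(u, x) \<in> ?Q ^^ m"
      using key[OF walk] False uN e(1) by blast
    show ?thesis
    proof (cases "v \<in> N e")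
      case True
      then show ?thesis using one e u v uN by blast
    next
      case vN: False
      \<comment> \<open>At least one step is spent inside \<open>C e\<close>, so at most \<open>h\<close> are left for the base.\<close>
      then have "m' \<noteq> 0" using x(1,3) by (cases m') auto
      then have "u = x" using baseE[OF uN x(1,4)] x(2) by simp
      then show ?thesis using copyE[OF u v, of m'] x(2,3) by simp
    qed
  qed
qed

lemma girth_ge_if_sparse:
  assumes sp: "sparse h E" and g: "g \<le> h + 2"
  shows "enat g \<le> girth V E"
  unfolding girth_def
proof (rule INF_greatest)
  fix c assume "c \<in> {c. is_cycle V E c}"
  then have len: "3 \<le> length c" and dist: "distinct c"
    and ed: "\<And>i. i < length c \<Longrightarrow> {c ! i, c ! (Suc i mod length c)} \<in> E"
    unfolding is_cycle_def by auto
  define l where "l = length c - 1"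
  have l: "length c = Suc l" "2 \<le> l" using len by (auto simp: l_def)
  define A where "A = {c ! l, c ! 0}"
  have A: "A \<in> E" using ed[of l] l by (simp add: A_def)
  have walk: "(c ! 0, c ! i) \<in> link (E - {A}) ^^ i" if "i \<le> l" for i
    using that
  proof (induction i)
    case (Suc i)
    have "{c ! i, c ! Suc i} \<in> E" using ed[of i] Suc.prems l by simp
    moreover have "{c ! i, c ! Suc i} \<noteq> A"
      using dist Suc.prems l unfolding A_def doubleton_eq_iff
      by (auto simp: nth_eq_iff_index_eq)
    ultimately have "(c ! i, c ! Suc i) \<in> link (E - {A})"
      by (auto intro!: linkI[of "{c ! i, c ! Suc i}"])
    then show ?case using Suc by (auto intro: relcompI)
  qed simp
  have "c ! 0 \<noteq> c ! l" using dist l by (auto simp: nth_eq_iff_index_eq)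
  then have "\<not> l \<le> h"
    using walk[of l] link_relpow_mono[of "c ! 0" "c ! l" l _ h] sp A
    unfolding sparse_def A_def by blast
  then show "enat g \<le> enat (length c)" using g l by simp
qed

section \<open>Sparse hypergraphs of large chromatic number\<close>

text \<open>All hypergraphs below have natural numbers as vertices. An amalgam consists of the vertices of
  the base (\<open>root\<close>) and, for each edge \<open>e\<close> of the base, private copies of further vertices (\<open>node e\<close>).
  The edge \<open>e\<close> is coded by a number, which is faithful as \<open>e\<close> is finite, and can be decoded when a
  function on the amalgam is defined by cases.\<close>
definition root :: "nat \<Rightarrow> nat" where "root x = prod_encode (0, x)"
definition node :: "nat set \<Rightarrow> nat \<Rightarrow> nat" where "node e w = prod_encode (Suc (set_encode e), w)"

definition vertex_case :: "(nat \<Rightarrow> 'b) \<Rightarrow> (nat set \<Rightarrow> nat \<Rightarrow> 'b) \<Rightarrow> nat \<Rightarrow> 'b" where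
  "vertex_case f g v =
     (case prod_decode v of (s, x) \<Rightarrow> (case s of 0 \<Rightarrow> f x | Suc s' \<Rightarrow> g (set_decode s') x))"

lemma vertex_case_root [simp]: "vertex_case f g (root x) = f x"
  by (simp add: vertex_case_def root_def)

lemma vertex_case_node [simp]: "finite e \<Longrightarrow> vertex_case f g (node e w) = g e w"
  by (simp add: vertex_case_def node_def)

lemma root_eq_iff [simp]: "root x = root y \<longleftrightarrow> x = y"
  by (simp add: root_def)

lemma root_neq_node [simp]: "root x \<noteq> node e w" "node e w \<noteq> root x"
  by (simp_all add: root_def node_def)

lemma node_eq_iff [simp]: "finite e \<Longrightarrow> finite f \<Longrightarrow> node e w = node f z \<longleftrightarrow> e = f \<and> w = z"
  by (auto simp: node_def set_encode_eq)

lemma inj_root: "inj root"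
  by (auto intro: injI)

lemma root_image_eq_iff [simp]: "root ` e = root ` f \<longleftrightarrow> e = f"
  by (rule inj_image_eq_iff[OF inj_root])

definition uniform :: "nat \<Rightarrow> 'a set set \<Rightarrow> bool" where
  "uniform N H \<longleftrightarrow> finite H \<and> (\<forall>e\<in>H. finite e \<and> card e = N)"

text \<open>Not \<open>r\<close>-colourable: every colouring has a monochromatic edge. The bound on \<open>b\<close> makes
  it one of the colours even if that edge is empty.\<close>
definition unavoidable :: "nat \<Rightarrow> 'a set set \<Rightarrow> bool" where
  "unavoidable r H \<longleftrightarrow> (\<forall>c::'a \<Rightarrow> nat. (\<forall>x. c x < r) \<longrightarrow> (\<exists>e\<in>H. \<exists>b<r. \<forall>x\<in>e. c x = b))"

lemma pigeonhole_monochromatic: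
  fixes d :: "nat \<Rightarrow> nat"
  assumes "\<And>i. d i < r"
  shows "\<exists>T\<subseteq>{..<Suc (N * r)}. card T = N \<and> (\<exists>b<r. \<forall>i\<in>T. d i = b)"
proof -
  let ?F = "\<lambda>b. {i. i < Suc (N * r) \<and> d i = b}"
  have "\<exists>b<r. N \<le> card (?F b)"
  proof (rule ccontr)
    assume *: "\<not> ?thesis"
    have "{..<Suc (N * r)} = (\<Union>b<r. ?F b)" using assms by auto
    then have "Suc (N * r) = card (\<Union>b<r. ?F b)" by (metis card_lessThan)
    also have "\<dots> \<le> (\<Sum>b<r. card (?F b))" by (rule card_UN_le) simp
    also have "\<dots> \<le> (\<Sum>b<r. N)" using * by (intro sum_mono) (auto simp: not_le less_imp_le)
    finally show False by (simp add: mult.commute)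
  qed
  then obtain b where b: "b < r" "N \<le> card (?F b)" by blast
  obtain T where "T \<subseteq> ?F b" "card T = N" using obtain_subset_with_card_n[OF b(2)] by blast
  then show ?thesis using b(1) by (intro exI[of _ T]) auto
qed

text \<open>The invariant of the partite construction. The vertices of \<open>P\<close> are divided into parts by \<open>\<pi>\<close>.
  Within every \<open>r\<close>-colouring one finds a system that has one edge over each \<open>N\<close>-set of parts, and that
  is monochromatic in each of the first \<open>k\<close> parts. For \<open>k = a\<close> the colours \<open>d\<close> of the parts
  form a colouring of the set of parts, and the pigeonhole principle applies to it.\<close>
definition traces ::
    "nat \<Rightarrow> nat \<Rightarrow> nat \<Rightarrow> nat \<Rightarrow> ('a \<Rightarrow> nat) \<Rightarrow> 'a set set \<Rightarrow> bool" where
  "traces r a N k \<pi> P \<longleftrightarrow> (\<forall>c. (\<forall>x. c x < r) \<longrightarrow> (\<exists>d. (\<forall>i. d i < r) \<and>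
     (\<forall>T\<subseteq>{..<a}. card T = N \<longrightarrow> (\<exists>A\<in>P. \<pi> ` A = T \<and> (\<forall>x\<in>A. \<pi> x < k \<longrightarrow> c x = d (\<pi> x))))))"

text \<open>The partite construction of Nesetril and Rodl. It starts with disjoint edges, one over each
  \<open>N\<close>-set of parts. To make part \<open>k\<close> monochromatic, take an unavoidable hypergraph \<open>H\<close> whose
  edges have as many elements as that part, and for each edge of \<open>H\<close> a copy of the old hypergraph whose
  part \<open>k\<close> is identified with the edge; the vertices of \<open>H\<close> are the new part \<open>k\<close>. As an edge meets a
  part at most once, amalgamation yields sparseness \<open>h + 1\<close> although \<open>H\<close> only has sparseness \<open>h\<close>.\<close>
lemma partite_amalgamation:
  assumes hyp: "\<And>M. \<exists>H :: nat set set. uniform M H \<and> sparse h H \<and> unavoidable r H"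
  shows "\<exists>(P :: nat set set) \<pi>. uniform N P \<and> sparse (Suc h) P \<and> (\<forall>A\<in>P. inj_on \<pi> A) \<and>
           traces r a N k \<pi> P"
proof (induction k)
  case 0
  define \<T> where "\<T> = {T. T \<subseteq> {..<a} \<and> card T = N}"
  define P where "P = (\<lambda>T. node T ` T) ` \<T>"
  define \<pi> where "\<pi> = vertex_case (\<lambda>x. x) (\<lambda>e w. w)"
  have fin: "finite T" if "T \<in> \<T>" for T using that by (auto simp: \<T>_def intro: finite_subset)
  have pi: "\<pi> ` node T ` T = T" if "T \<in> \<T>" for T
    using fin[OF that] by (force simp: \<pi>_def image_image)
  have "finite \<T>" by (simp add: \<T>_def)
  have "finite (node T ` T) \<and> card (node T ` T) = N" if "T \<in> \<T>" for T
  proof -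
    have "inj_on (node T) T" using fin[OF that] by (simp add: inj_on_def)
    then show ?thesis using fin[OF that] that by (simp add: card_image \<T>_def)
  qed
  then have "uniform N P" using \<open>finite \<T>\<close> by (auto simp: uniform_def P_def)
  moreover have "sparse (Suc h) P"
    unfolding sparse_def
  proof (intro ballI impI)
    fix A u v assume A: "A \<in> P" "u \<in> A" "(u, v) \<in> link (P - {A}) ^^ Suc h"
    then obtain T w where T: "T \<in> \<T>" "A = node T ` T" "u = node T w" by (auto simp: P_def)
    have "u \<notin> B" if B: "B \<in> P" "B \<noteq> A" for B
    proof -
      obtain T' where T': "T' \<in> \<T>" "B = node T' ` T'" using B(1) by (auto simp: P_def)
      then have "T' \<noteq> T" using B(2) T(2) by blast
      then show ?thesis using T' T fin by auto
    qed
    then have "u \<notin> \<Union> (P - {A})" by blast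
    then show "u = v" using link_relpow_isolated[OF A(3)] by blast
  qed
  moreover have "\<forall>A\<in>P. inj_on \<pi> A"
  proof
    fix A assume "A \<in> P"
    then obtain T where T: "T \<in> \<T>" "A = node T ` T" by (auto simp: P_def)
    show "inj_on \<pi> A" unfolding T(2) using fin[OF T(1)] by (simp add: \<pi>_def inj_on_def)
  qed
  moreover have "traces r a N 0 \<pi> P"
    unfolding traces_def
  proof (intro allI impI)
    fix c :: "nat \<Rightarrow> nat" assume "\<forall>x. c x < r"
    then show "\<exists>d. (\<forall>i. d i < r) \<and> (\<forall>T\<subseteq>{..<a}. card T = N \<longrightarrow>
        (\<exists>A\<in>P. \<pi> ` A = T \<and> (\<forall>x\<in>A. \<pi> x < 0 \<longrightarrow> c x = d (\<pi> x))))"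
      using pi by (intro exI[of _ c]) (auto simp: P_def \<T>_def)
  qed
  ultimately show ?case by blast
next
  case (Suc k)
  then obtain P :: "nat set set" and \<pi> where P: "uniform N P" "sparse (Suc h) P"
      "\<And>A. A \<in> P \<Longrightarrow> inj_on \<pi> A" "traces r a N k \<pi> P" by blast
  define Z where "Z = {x \<in> \<Union>P. \<pi> x = k}"
  have "finite Z" using P(1) by (auto simp: Z_def uniform_def)
  obtain H :: "nat set set" where H: "uniform (card Z) H" "sparse h H" "unavoidable r H"
    using hyp by blast
  have finH: "finite e" if "e \<in> H" for e using H(1) that by (simp add: uniform_def)
  have "\<exists>b. bij_betw b Z e" if "e \<in> H" for e
    using H(1) that \<open>finite Z\<close> finite_same_card_bij[of Z e] by (simp add: uniform_def)
  then obtain b where b: "\<And>e. e \<in> H \<Longrightarrow> bij_betw (b e) Z e" by metis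
  have be: "b e w \<in> e" if "e \<in> H" "w \<in> Z" for e w
    using b[OF that(1)] that(2) by (auto simp: bij_betw_def)
  define \<iota> where "\<iota> e w = (if w \<in> Z then root (b e w) else node e w)" for e w
  have inj: "inj_on (\<iota> e) S" if "e \<in> H" for e S
    using b[OF that] finH[OF that] by (auto simp: \<iota>_def inj_on_def bij_betw_def)
  define Q where "Q = (\<Union>e\<in>H. (`) (\<iota> e) ` P)"
  define \<rho> where "\<rho> = vertex_case (\<lambda>_. k) (\<lambda>e w. \<pi> w)"
  have \<rho>: "\<rho> (\<iota> e w) = \<pi> w" if "e \<in> H" for e w
    using finH[OF that] by (auto simp: \<rho>_def \<iota>_def Z_def)
  have "uniform N Q"
    using P(1) H(1) inj by (auto simp: Q_def uniform_def card_image)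
  moreover have "sparse (Suc h) Q"
    unfolding Q_def
  proof (rule sparse_glue[where N = "image root" and W = "\<lambda>e. range (node e)"])
    show "sparse h ((`) root ` H)"
      by (rule sparse_image[OF H(2)]) (auto simp: inj_on_def)
    show "inj_on (image root) H" by (auto simp: inj_on_def)
    show "sparse (Suc h) ((`) (\<iota> e) ` P)" if "e \<in> H" for e
      by (rule sparse_image[OF P(2) inj[OF that]])
    show "A \<subseteq> root ` e \<union> range (node e)" if "e \<in> H" "A \<in> (`) (\<iota> e) ` P" for e A
      using that be by (auto simp: \<iota>_def)
    show "x = y" if "e \<in> H" "A \<in> (`) (\<iota> e) ` P" "x \<in> A \<inter> root ` e" "y \<in> A \<inter> root ` e" for e A x y
    proof -
      note asm = that
      obtain B where B: "B \<in> P" "A = \<iota> e ` B" using asm(2) by blast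
      obtain w w' where w: "w \<in> B" "x = \<iota> e w" "w' \<in> B" "y = \<iota> e w'" using asm(3,4) B(2) by blast
      have "w \<in> Z" "w' \<in> Z" using asm(3,4) w by (auto simp: \<iota>_def split: if_splits)
      then have "\<pi> w = \<pi> w'" by (simp add: Z_def)
      then show ?thesis using P(3)[OF B(1)] w by (auto dest: inj_onD)
    qed
    show "range (node e) \<inter> root ` f = {}" for e f by auto
    show "range (node e) \<inter> range (node f) = {}" if "e \<in> H" "f \<in> H" "e \<noteq> f" for e f
      using that finH by auto
  qed
  moreover have "\<forall>A\<in>Q. inj_on \<rho> A"
    using P(3) by (auto simp: Q_def inj_on_def \<rho>)
  moreover have "traces r a N (Suc k) \<rho> Q"
    unfolding traces_def
  proof (intro allI impI)
    fix c :: "nat \<Rightarrow> nat" assume c: "\<forall>x. c x < r"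
    obtain e y where e: "e \<in> H" "y < r" "\<And>x. x \<in> e \<Longrightarrow> c (root x) = y"
      using H(3) c unfolding unavoidable_def by (elim allE[of _ "\<lambda>x. c (root x)"]) auto
    obtain d where d: "\<forall>i. d i < r"
      "\<And>T. T \<subseteq> {..<a} \<Longrightarrow> card T = N \<Longrightarrow>
         \<exists>A\<in>P. \<pi> ` A = T \<and> (\<forall>x\<in>A. \<pi> x < k \<longrightarrow> c (\<iota> e x) = d (\<pi> x))"
      using P(4) c unfolding traces_def by (elim allE[of _ "\<lambda>x. c (\<iota> e x)"]) auto
    have "\<exists>A\<in>Q. \<rho> ` A = T \<and> (\<forall>x\<in>A. \<rho> x < Suc k \<longrightarrow> c x = (d(k := y)) (\<rho> x))"
      if T: "T \<subseteq> {..<a}" "card T = N" for T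
    proof -
      obtain A where A: "A \<in> P" "\<pi> ` A = T" "\<forall>x\<in>A. \<pi> x < k \<longrightarrow> c (\<iota> e x) = d (\<pi> x)"
        using d(2)[OF T] by blast
      have "c (\<iota> e x) = y" if "x \<in> A" "\<pi> x = k" for x
      proof -
        have "x \<in> Z" using that A(1) by (auto simp: Z_def)
        then show ?thesis using e(3) be[OF e(1)] by (simp add: \<iota>_def)
      qed
      then have "\<forall>x\<in>\<iota> e ` A. \<rho> x < Suc k \<longrightarrow> c x = (d(k := y)) (\<rho> x)"
        using A(3) by (auto simp: \<rho>[OF e(1)] less_Suc_eq)
      moreover have "\<rho> ` \<iota> e ` A = T" using A(2) by (simp add: image_image \<rho>[OF e(1)])
      moreover have "\<iota> e ` A \<in> Q" using A(1) e(1) by (auto simp: Q_def)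
      ultimately show ?thesis by blast
    qed
    moreover have "\<forall>i. (d(k := y)) i < r" using d(1) e(2) by simp
    ultimately show "\<exists>d. (\<forall>i. d i < r) \<and> (\<forall>T\<subseteq>{..<a}. card T = N \<longrightarrow>
        (\<exists>A\<in>Q. \<rho> ` A = T \<and> (\<forall>x\<in>A. \<rho> x < Suc k \<longrightarrow> c x = d (\<rho> x))))"
      by blast
  qed
  ultimately show ?case by blast
qed

text \<open>Uniform hypergraphs of large girth and large chromatic number (Erdos and Hajnal), by induction
  on the girth. The base case is the complete uniform hypergraph on sufficiently many vertices.\<close>
theorem sparse_unavoidable_hypergraph:
  "\<exists>H :: nat set set. uniform N H \<and> sparse h H \<and> unavoidable r H"
proof (induction h arbitrary: N)
  case 0
  define H where "H = {T. T \<subseteq> {..<Suc (N * r)} \<and> card T = N}"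
  have "uniform N H" by (auto simp: uniform_def H_def intro: finite_subset)
  moreover have "sparse 0 H" by (simp add: sparse_def)
  moreover have "unavoidable r H"
    unfolding unavoidable_def
  proof (intro allI impI)
    fix c :: "nat \<Rightarrow> nat" assume "\<forall>x. c x < r"
    then obtain T where "T \<subseteq> {..<Suc (N * r)}" "card T = N" "\<exists>b<r. \<forall>i\<in>T. c i = b"
      using pigeonhole_monochromatic[of c r N] by blast
    then show "\<exists>e\<in>H. \<exists>b<r. \<forall>x\<in>e. c x = b" by (auto simp: H_def)
  qed
  ultimately show ?case by blast
next
  case (Suc h)
  let ?a = "Suc (N * r)"
  obtain P :: "nat set set" and \<pi> where P: "uniform N P" "sparse (Suc h) P"
      "traces r ?a N ?a \<pi> P" using partite_amalgamation[OF Suc.IH] by blast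
  have "unavoidable r P"
    unfolding unavoidable_def
  proof (intro allI impI)
    fix c :: "nat \<Rightarrow> nat" assume "\<forall>x. c x < r"
    then obtain d where d: "\<And>i. d i < r"
      "\<And>T. T \<subseteq> {..<?a} \<Longrightarrow> card T = N \<Longrightarrow>
         \<exists>A\<in>P. \<pi> ` A = T \<and> (\<forall>x\<in>A. \<pi> x < ?a \<longrightarrow> c x = d (\<pi> x))"
      using P(3) unfolding traces_def by (elim allE[of _ c]) auto
    obtain T b where T: "T \<subseteq> {..<?a}" "card T = N" "b < r" "\<forall>i\<in>T. d i = b"
      using pigeonhole_monochromatic[of d r N] d(1) by blast
    obtain A where A: "A \<in> P" "\<pi> ` A = T" "\<forall>x\<in>A. \<pi> x < ?a \<longrightarrow> c x = d (\<pi> x)"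
      using d(2)[OF T(1,2)] by blast
    have "c x = b" if "x \<in> A" for x
    proof -
      have "\<pi> x \<in> T" using that A(2) by blast
      then show ?thesis using A(3) T(1,4) that by auto
    qed
    then show "\<exists>e\<in>P. \<exists>b<r. \<forall>x\<in>e. c x = b" using A(1) T(3) by blast
  qed
  then show ?case using P by blast
qed

section \<open>Hanging copies of graphs on the edges of a hypergraph\<close>

text \<open>In the graphs built below, a copy hanging on the edge \<open>e\<close> carries a number \<open>a\<close> in addition,
  because several graphs hang on the same edge.\<close>
definition copy :: "nat set \<Rightarrow> nat \<Rightarrow> nat \<Rightarrow> nat" where
  "copy e a w = node e (prod_encode (a, w))"

definition attachment_case :: "(nat \<Rightarrow> 'b) \<Rightarrow> (nat set \<Rightarrow> nat \<Rightarrow> nat \<Rightarrow> 'b) \<Rightarrow> nat \<Rightarrow> 'b" where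
  "attachment_case f g = vertex_case f (\<lambda>e y. case prod_decode y of (a, w) \<Rightarrow> g e a w)"

lemma attachment_case_simps [simp]:
  "attachment_case f g (root x) = f x"
  "finite e \<Longrightarrow> attachment_case f g (copy e a w) = g e a w"
  by (simp_all add: attachment_case_def copy_def)

lemma copy_eq_iff [simp]:
  "finite e \<Longrightarrow> finite e' \<Longrightarrow> copy e a w = copy e' a' w' \<longleftrightarrow> e = e' \<and> a = a' \<and> w = w'"
  by (simp add: copy_def)

lemma root_neq_copy [simp]: "root x \<noteq> copy e a w" "copy e a w \<noteq> root x"
  by (simp_all add: copy_def)

text \<open>Descartes' construction with several graphs at a time. For each edge \<open>e\<close> of \<open>H\<close> and each
  index \<open>a\<close> there is a copy of the graph \<open>a\<close>. Each vertex \<open>w\<close> of that copy is joined to \<open>m a\<close>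
  vertices of \<open>e\<close>, and \<open>b e\<close> arranges that different \<open>w\<close> and different \<open>a\<close> use different vertices
  of \<open>e\<close>. Seen from the copies on \<open>e\<close>, the edges to \<open>e\<close> are pendant, so a short cycle could
  only come from a short cycle of \<open>H\<close> or of one of the graphs.\<close>
locale attachment =
  fixes H :: "nat set set" and A :: "nat set" and V :: "nat \<Rightarrow> nat set"
    and E :: "nat \<Rightarrow> nat set set" and m :: "nat \<Rightarrow> nat" and b :: "nat set \<Rightarrow> nat \<times> nat \<times> nat \<Rightarrow> nat"
  assumes finite_H: "finite H" and finite_edge: "\<And>e. e \<in> H \<Longrightarrow> finite e"
    and finite_A: "finite A" and graph: "\<And>a. a \<in> A \<Longrightarrow> simple_graph (V a) (E a)"
    and bij: "\<And>e. e \<in> H \<Longrightarrow> bij_betw (b e) (SIGMA a:A. SIGMA w:V a. {..<m a}) e"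
begin

definition vertices :: "nat set" where
  "vertices = root ` \<Union>H \<union> {copy e a w | e a w. e \<in> H \<and> a \<in> A \<and> w \<in> V a}"

definition hanging :: "nat set \<Rightarrow> nat set set" where
  "hanging e = {{copy e a u, copy e a w} | a u w. a \<in> A \<and> {u, w} \<in> E a} \<union>
     {{root (b e (a, w, t)), copy e a w} | a w t. a \<in> A \<and> w \<in> V a \<and> t < m a}"

definition edges :: "nat set set" where
  "edges = (\<Union>e\<in>H. hanging e)"

lemma E_D: "a \<in> A \<Longrightarrow> {u, w} \<in> E a \<Longrightarrow> u \<in> V a \<and> w \<in> V a \<and> u \<noteq> w"
  using graph[of a] by (auto simp: simple_graph_def)

lemma b_in: "e \<in> H \<Longrightarrow> a \<in> A \<Longrightarrow> w \<in> V a \<Longrightarrow> t < m a \<Longrightarrow> b e (a, w, t) \<in> e"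
  using bij[of e] by (auto simp: bij_betw_def)

lemma b_eq_iff:
  assumes "e \<in> H" "a \<in> A" "w \<in> V a" "t < m a" "a' \<in> A" "w' \<in> V a'" "t' < m a'"
  shows "b e (a, w, t) = b e (a', w', t') \<longleftrightarrow> a = a' \<and> w = w' \<and> t = t'"
  using bij[OF assms(1)] inj_on_eq_iff[of "b e" _ "(a, w, t)" "(a', w', t')"] assms
  by (auto simp: bij_betw_def)

lemma inner_in_edges:
  assumes "e \<in> H" "a \<in> A" "{u, w} \<in> E a"
  shows "{copy e a u, copy e a w} \<in> edges"
proof -
  have "{copy e a u, copy e a w} \<in> hanging e" using assms(2,3) unfolding hanging_def by blast
  then show ?thesis using assms(1) unfolding edges_def by blast
qed

lemma peg_in_edges:
  assumes "e \<in> H" "a \<in> A" "w \<in> V a" "t < m a"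
  shows "{root (b e (a, w, t)), copy e a w} \<in> edges"
proof -
  have "{root (b e (a, w, t)), copy e a w} \<in> hanging e"
    using assms(2-4) unfolding hanging_def by blast
  then show ?thesis using assms(1) unfolding edges_def by blast
qed

lemma hanging_cases [consumes 1, case_names inner peg]:
  assumes "B \<in> hanging e"
  obtains a u w where "a \<in> A" "{u, w} \<in> E a" "B = {copy e a u, copy e a w}"
  | a w t where "a \<in> A" "w \<in> V a" "t < m a" "B = {root (b e (a, w, t)), copy e a w}"
  using assms unfolding hanging_def by blast

lemma edge_cases [consumes 1, case_names inner peg peg']:
  assumes "{x, y} \<in> edges"
  obtains e a u w where "e \<in> H" "a \<in> A" "{u, w} \<in> E a" "x = copy e a u" "y = copy e a w"
  | e a w t where "e \<in> H" "a \<in> A" "w \<in> V a" "t < m a" "x = root (b e (a, w, t))" "y = copy e a w"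
  | e a w t where "e \<in> H" "a \<in> A" "w \<in> V a" "t < m a" "y = root (b e (a, w, t))" "x = copy e a w"
proof -
  obtain e where e: "e \<in> H" "{x, y} \<in> hanging e" using assms by (auto simp: edges_def)
  from e(2) show thesis
  proof (cases rule: hanging_cases)
    case (inner a u w)
    then show ?thesis
      using that(1)[OF e(1) inner(1), of u w] that(1)[OF e(1) inner(1), of w u]
      by (auto simp: doubleton_eq_iff insert_commute)
  next
    case (peg a w t)
    then show ?thesis
      using that(2)[OF e(1) peg(1-3)] that(3)[OF e(1) peg(1-3)] by (auto simp: doubleton_eq_iff)
  qed
qed

lemma simple_graph_attachment: "simple_graph vertices edges"
proof -
  have "vertices = root ` \<Union>H \<union> (\<Union>e\<in>H. \<Union>a\<in>A. copy e a ` V a)"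
    unfolding vertices_def by blast
  moreover have "finite (V a)" if "a \<in> A" for a using graph[OF that] by (simp add: simple_graph_def)
  ultimately have "finite vertices" using finite_H finite_edge finite_A by simp
  moreover have "B \<subseteq> vertices \<and> card B = 2" if B: "B \<in> hanging e" and e: "e \<in> H" for B e
    using B
  proof (cases rule: hanging_cases)
    case (inner a u w)
    then show ?thesis using E_D[OF inner(1,2)] finite_edge[OF e] e by (auto simp: vertices_def)
  next
    case (peg a w t)
    then show ?thesis using b_in[OF e peg(1-3)] e by (auto simp: vertices_def)
  qed
  ultimately show ?thesis unfolding simple_graph_def edges_def by blast
qed

text \<open>Pendant edges create no cycles: contract each of them into the copy to which it belongs, and
  collapse the other copies on \<open>e\<close> to a point. This turns a walk that avoids an edge of the copy \<open>a\<close>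
  into a walk of the graph \<open>a\<close> that avoids that edge. A walk that avoids a pendant edge cannot reach
  its outer end.\<close>
lemma sparse_hanging:
  assumes e: "e \<in> H" and sp: "\<And>a. a \<in> A \<Longrightarrow> sparse n (E a)"
  shows "sparse n (hanging e)"
  unfolding sparse_def
proof (intro ballI impI)
  fix B p q
  assume B: "B \<in> hanging e" "p \<in> B" "q \<in> B" and walk: "(p, q) \<in> link (hanging e - {B}) ^^ n"
  note fe [simp] = finite_edge[OF e]
  from B(1) show "p = q"
  proof (cases rule: hanging_cases)
    case (inner a u w)
    note B_eq = inner(3)
    define root_to where "root_to x = (case inv_into (SIGMA a:A. SIGMA w:V a. {..<m a}) (b e) x of
      (a', w', t) \<Rightarrow> if a' = a then w' else u)" for x
    have root_to: "root_to (b e (a', w', t)) = (if a' = a then w' else u)"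
      if "a' \<in> A" "w' \<in> V a'" "t < m a'" for a' w' t
      using that bij[OF e] by (simp add: root_to_def bij_betw_def inv_into_f_f)
    define \<rho> where "\<rho> = attachment_case root_to (\<lambda>e a' w'. if a' = a then w' else u)"
    have "(\<rho> p, \<rho> q) \<in> link (E a - {{u, w}}) ^^ n"
    proof (rule relpow_map[OF walk])
      fix x y assume "(x, y) \<in> link (hanging e - {B})"
      then consider "x = y" | C where "C \<in> hanging e" "C \<noteq> B" "x \<in> C" "y \<in> C"
        unfolding link_def by blast
      then show "(\<rho> x, \<rho> y) \<in> link (E a - {{u, w}})"
      proof cases
        case (2 C)
        from 2(1) show ?thesis
        proof (cases rule: hanging_cases)
          case (inner a' u' w')
          note inner' = this
          show ?thesis
          proof (cases "a' = a")
            case True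
            then have "{u', w'} \<noteq> {u, w}" using inner' 2(2) B_eq by (auto simp: doubleton_eq_iff)
            then have "{u', w'} \<in> E a - {{u, w}}" using inner' True by blast
            then show ?thesis
              by (rule linkI) (use 2 inner' True in \<open>auto simp: \<rho>_def\<close>)
          next
            case False
            then have "\<rho> x = \<rho> y" using 2 inner' by (auto simp: \<rho>_def)
            then show ?thesis by simp
          qed
        next
          case (peg a' w' t)
          then have "\<rho> x = \<rho> y" using 2 root_to[OF peg(1-3)] by (auto simp: \<rho>_def)
          then show ?thesis by simp
        qed
      qed simp
    qed
    moreover have "\<rho> (copy e a z) = z" for z by (simp add: \<rho>_def)
    then have "\<rho> p \<in> {u, w}" "\<rho> q \<in> {u, w}" "\<rho> p = \<rho> q \<Longrightarrow> p = q"
      using B(2,3) B_eq by auto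
    ultimately show ?thesis using sp[OF inner(1)] inner(2) unfolding sparse_def by blast
  next
    case (peg a w t)
    have "root (b e (a, w, t)) \<notin> C" if C: "C \<in> hanging e" "C \<noteq> B" for C
      using C(1)
    proof (cases rule: hanging_cases)
      case (peg a' w' t')
      then show ?thesis
        using C(2) \<open>B = _\<close> b_eq_iff[OF e \<open>a \<in> A\<close> \<open>w \<in> V a\<close> \<open>t < m a\<close> peg(1-3)] by auto
    qed auto
    then have "root (b e (a, w, t)) \<notin> \<Union> (hanging e - {B})" by blast
    then have "p = root (b e (a, w, t)) \<or> q = root (b e (a, w, t)) \<Longrightarrow> p = q"
      using link_relpow_isolated[OF walk] by blast
    then show ?thesis using B(2,3) peg(4) by auto
  qed
qed

lemma sparse_attachment:
  assumes "sparse h H" and "\<And>a. a \<in> A \<Longrightarrow> sparse (Suc h) (E a)"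
  shows "sparse (Suc h) edges"
  unfolding edges_def
proof (rule sparse_glue[where N = "image root" and W = "\<lambda>e. range (node e)"])
  show "sparse h ((`) root ` H)"
    by (rule sparse_image[OF assms(1)]) (auto simp: inj_on_def)
  show "inj_on (image root) H" by (auto simp: inj_on_def)
  show "sparse (Suc h) (hanging e)" if "e \<in> H" for e
    by (rule sparse_hanging[OF that assms(2)])
  show "B \<subseteq> root ` e \<union> range (node e)" if e: "e \<in> H" and B: "B \<in> hanging e" for e B
    using B
  proof (cases rule: hanging_cases)
    case (peg a w t)
    then show ?thesis using b_in[OF e peg(1-3)] by (auto simp: copy_def)
  qed (auto simp: copy_def)
  show "x = y" if B: "B \<in> hanging e" and xy: "x \<in> B \<inter> root ` e" "y \<in> B \<inter> root ` e" for e B x y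
    using B by (cases rule: hanging_cases) (use xy in auto)
  show "range (node e) \<inter> root ` f = {}" for e f by auto
  show "range (node e) \<inter> range (node f) = {}" if "e \<in> H" "f \<in> H" "e \<noteq> f" for e f
    using that finite_edge by auto
qed

end

section \<open>Gadgets\<close>

text \<open>A colour is a pair of the index of its class and a number.\<close>
definition colour_class :: "nat \<Rightarrow> nat" where
  "colour_class c = fst (prod_decode c)"

lemma colour_class_prod_encode [simp]: "colour_class (prod_encode (j, n)) = j"
  by (simp add: colour_class_def)

text \<open>The index set \<open>D\<close> consists of parts of \<open>ms\<close> that have been assigned to types by \<open>\<phi>\<close>.\<close>
definition load :: "nat list \<Rightarrow> nat set \<Rightarrow> (nat \<Rightarrow> nat) \<Rightarrow> nat \<Rightarrow> nat" where
  "load ms D \<phi> i = (\<Sum>j\<in>{j\<in>D. \<phi> j = i}. ms ! j)"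

lemma load_insert:
  assumes "finite D" "j \<notin> D"
  shows "load ms (insert j D) (\<phi>(j := i)) i' = load ms D \<phi> i' + (if i' = i then ms ! j else 0)"
proof -
  have "{x \<in> insert j D. (\<phi>(j := i)) x = i'} =
      (if i' = i then insert j {x \<in> D. \<phi> x = i'} else {x \<in> D. \<phi> x = i'})"
    using assms(2) by auto
  then show ?thesis using assms by (simp add: load_def)
qed

text \<open>Only edges between vertices of the same type matter here, and lists of size \<open>s i\<close> suffice for
  vertices of type \<open>i\<close>.\<close>
definition typed_choosable ::
    "nat set \<Rightarrow> nat set set \<Rightarrow> (nat \<Rightarrow> nat) \<Rightarrow> (nat \<Rightarrow> nat) \<Rightarrow> bool" where
  "typed_choosable V E ty s \<longleftrightarrow>
     (\<forall>M :: nat \<Rightarrow> nat set. (\<forall>v\<in>V. finite (M v) \<and> s (ty v) \<le> card (M v)) \<longrightarrow>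
        (\<exists>f. (\<forall>v\<in>V. f v \<in> M v) \<and> (\<forall>u v. {u, v} \<in> E \<longrightarrow> ty u = ty v \<longrightarrow> f u \<noteq> f v)))"

definition class_lists :: "nat set \<Rightarrow> nat list \<Rightarrow> nat set \<Rightarrow> (nat \<Rightarrow> nat set) \<Rightarrow> bool" where
  "class_lists V ms J L \<longleftrightarrow> (\<forall>v\<in>V. finite (L v) \<and> colour_class ` L v \<subseteq> J \<and>
     (\<forall>j\<in>J. card {c \<in> L v. colour_class c = j} = ms ! j))"

text \<open>A gadget for the state \<open>D, \<phi>\<close>. Its lists avoid the colour classes in \<open>D\<close>: these are thought of as
  already unusable for its vertices, a class \<open>j\<close> with \<open>\<phi> j = i\<close> because of \<open>ms ! j\<close> further
  neighbours of type \<open>i\<close>. Only for vertices that have type \<open>i\<close> themselves do these neighbours count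
  against choosability within a type. This is the reason for subtracting the load of \<open>i\<close> from
  \<open>ns ! i\<close>. For \<open>D = {}\<close> a gadget is a graph with the properties wanted in the end.\<close>
definition gadget ::
    "nat \<Rightarrow> nat list \<Rightarrow> nat list \<Rightarrow> nat set \<Rightarrow> (nat \<Rightarrow> nat) \<Rightarrow>
     nat set \<Rightarrow> nat set set \<Rightarrow> (nat \<Rightarrow> nat) \<Rightarrow> (nat \<Rightarrow> nat set) \<Rightarrow> bool" where
  "gadget h ns ms D \<phi> V E ty L \<longleftrightarrow>
     simple_graph V E \<and> sparse h E \<and> ty ` V \<subseteq> {..<length ns} \<and>
     typed_choosable V E ty (\<lambda>i. ns ! i - load ms D \<phi> i) \<and>
     class_lists V ms ({..<length ms} - D) L \<and> \<not> list_colourable V E L"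

text \<open>The roots, of type \<open>i\<close>, get pairwise disjoint lists whose colours are numbered by the same
  set \<open>A\<close> of slots. In any list colouring of the roots the hypergraph contains an edge \<open>e\<close> all of whose
  vertices use the same slot \<open>a\<close>. One of the copies on \<open>e\<close> has guessed this slot: if \<open>j\<close> is the
  class of \<open>a\<close>, it is a copy of a gadget for \<open>insert j D\<close>, and each of its vertices has
  received in its list the \<open>ms ! j\<close> colours of slot \<open>a\<close> that its neighbours in \<open>e\<close> have. These
  colours are all forbidden, and the remaining list admits no colouring.

  Within a type the graph stays choosable from small lists: colour the roots first, which is
  possible since \<open>ns ! i\<close> exceeds the load of \<open>i\<close>. A copy vertex of type \<open>i\<close> then loses at most
  \<open>ms ! j\<close> colours, and precisely this amount has been added to the load of \<open>i\<close> in its gadget.\<close>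
lemma gadget_step:
  assumes D: "D \<subset> {..<length ms}" and pos: "\<And>j. j < length ms \<Longrightarrow> 0 < ms ! j"
    and i: "i < length ns" "load ms D \<phi> i < ns ! i"
    and IH: "\<And>j. j < length ms \<Longrightarrow> j \<notin> D \<Longrightarrow>
               \<exists>V E ty L. gadget (Suc h) ns ms (insert j D) (\<phi>(j := i)) V E ty L"
  shows "\<exists>V E ty L. gadget (Suc h) ns ms D \<phi> V E ty L"
proof -
  let ?J = "{..<length ms} - D"
  have "finite D" using D finite_subset by blast
  have "\<exists>V E ty L. j \<in> ?J \<longrightarrow> gadget (Suc h) ns ms (insert j D) (\<phi>(j := i)) V E ty L" for j
    using IH[of j] by auto
  then obtain VV EE tt LL where
    G: "\<And>j. j \<in> ?J \<Longrightarrow> gadget (Suc h) ns ms (insert j D) (\<phi>(j := i)) (VV j) (EE j) (tt j) (LL j)"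
    by metis
  \<comment> \<open>The slots: a class \<open>j\<close> and a position \<open>t\<close> in the part of a list that belongs to that class.\<close>
  define A where "A = prod_encode ` (SIGMA j:?J. {..<ms ! j})"
  have "finite A" by (simp add: A_def)
  have clsA: "colour_class a \<in> ?J" if "a \<in> A" for a using that by (auto simp: A_def)
  obtain j0 where j0: "j0 \<in> ?J" using D by blast
  then have a0: "prod_encode (j0, 0) \<in> A" using pos by (auto simp: A_def)
  have cardA: "card {a \<in> A. colour_class a = j} = ms ! j" if "j \<in> ?J" for j
  proof -
    have "{a \<in> A. colour_class a = j} = (\<lambda>t. prod_encode (j, t)) ` {..<ms ! j}"
      using that by (auto simp: A_def)
    then show ?thesis by (simp add: card_image inj_on_def)
  qed
  define V where "V a = VV (colour_class a)" for a
  define E where "E a = EE (colour_class a)" for a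
  define m where "m a = ms ! colour_class a" for a
  note G' = G[OF clsA, unfolded gadget_def, folded V_def E_def]
  have graph: "simple_graph (V a) (E a)" and spE: "sparse (Suc h) (E a)"
    and ttV: "tt (colour_class a) ` V a \<subseteq> {..<length ns}"
    and choos: "typed_choosable (V a) (E a) (tt (colour_class a))
      (\<lambda>i'. ns ! i' - load ms (insert (colour_class a) D) (\<phi>(colour_class a := i)) i')"
    and lists: "class_lists (V a) ms ({..<length ms} - insert (colour_class a) D) (LL (colour_class a))"
    and bad: "\<not> list_colourable (V a) (E a) (LL (colour_class a))"
    if "a \<in> A" for a
    using G'[OF that] by simp_all
  have Lfin: "finite (LL (colour_class a) w)"
    and Lcls: "colour_class ` LL (colour_class a) w \<subseteq> {..<length ms} - insert (colour_class a) D"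
    and Lcard: "\<And>j. j \<in> ?J \<Longrightarrow> j \<noteq> colour_class a \<Longrightarrow> card {c \<in> LL (colour_class a) w. colour_class c = j} = ms ! j"
    if "a \<in> A" "w \<in> V a" for a w
    using lists[OF that(1)] that(2) by (simp_all add: class_lists_def)
  let ?Z = "SIGMA a:A. SIGMA w:V a. {..<m a}"
  have "finite ?Z" using \<open>finite A\<close> graph by (auto simp: simple_graph_def intro!: finite_SigmaI)
  obtain r where r: "\<forall>a\<in>A. a < r" using \<open>finite A\<close> finite_nat_set_iff_bounded by blast
  obtain H :: "nat set set" where H: "uniform (card ?Z) H" "sparse h H" "unavoidable r H"
    using sparse_unavoidable_hypergraph by blast
  have "\<exists>b. bij_betw b ?Z e" if "e \<in> H" for e
    using H(1) that \<open>finite ?Z\<close> finite_same_card_bij[of ?Z e] by (simp add: uniform_def)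
  then obtain b where b: "\<And>e. e \<in> H \<Longrightarrow> bij_betw (b e) ?Z e" by metis
  interpret attachment H A V E m b
    using H(1) \<open>finite A\<close> graph b by unfold_locales (auto simp: uniform_def)
  have Vne: "V a \<noteq> {}" if "a \<in> A" for a
  proof
    assume "V a = {}"
    then have "list_colourable (V a) (E a) (LL (colour_class a))"
      using E_D[OF that] by (auto simp: list_colourable_def)
    then show False using bad[OF that] by blast
  qed
  have H_ne: "e \<noteq> {}" if "e \<in> H" for e
  proof -
    obtain w where "w \<in> V (prod_encode (j0, 0))" using Vne[OF a0] by blast
    moreover have "0 < m (prod_encode (j0, 0))" using j0 pos by (simp add: m_def)
    ultimately show ?thesis using b_in[OF that a0] by blast
  qed
  define ty where "ty = attachment_case (\<lambda>_. i) (\<lambda>e a w. tt (colour_class a) w)"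
  define col where "col a x = prod_encode (colour_class a, prod_encode (a, x))" for a x
  have colour_class_col [simp]: "colour_class (col a x) = colour_class a" for a x by (simp add: col_def)
  have col_eq [simp]: "col a x = col a' x' \<longleftrightarrow> a = a' \<and> x = x'" for a x a' x'
    by (auto simp: col_def)
  define L where "L = attachment_case (\<lambda>x. (\<lambda>a. col a x) ` A)
      (\<lambda>e a w. LL (colour_class a) w \<union> (\<lambda>t. col a (b e (a, w, t))) ` {..<m a})"
  have L_root: "L (root x) = (\<lambda>a. col a x) ` A" for x by (simp add: L_def)
  have L_copy: "L (copy e a w) = LL (colour_class a) w \<union> (\<lambda>t. col a (b e (a, w, t))) ` {..<m a}"
    if "e \<in> H" for e a w using finite_edge[OF that] by (simp add: L_def)
  have ty_root: "ty (root x) = i" for x by (simp add: ty_def)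
  have ty_copy: "ty (copy e a w) = tt (colour_class a) w" if "e \<in> H" for e a w
    using finite_edge[OF that] by (simp add: ty_def)

  have "typed_choosable vertices edges ty (\<lambda>i. ns ! i - load ms D \<phi> i)"
    unfolding typed_choosable_def
  proof (intro allI impI)
    fix M :: "nat \<Rightarrow> nat set"
    assume M: "\<forall>v\<in>vertices. finite (M v) \<and> ns ! ty v - load ms D \<phi> (ty v) \<le> card (M v)"
    have "\<exists>c. x \<in> \<Union>H \<longrightarrow> c \<in> M (root x)" for x
    proof (cases "x \<in> \<Union>H")
      case True
      then have "root x \<in> vertices" by (simp add: vertices_def)
      then have "ns ! i - load ms D \<phi> i \<le> card (M (root x))"
        using M ty_root by metis
      then have "card (M (root x)) \<noteq> 0" using i(2) by simp
      then show ?thesis by (auto simp: card_eq_0_iff)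
    qed simp
    then obtain f\<^sub>0 where f0: "\<And>x. x \<in> \<Union>H \<Longrightarrow> f\<^sub>0 x \<in> M (root x)" by metis
    \<comment> \<open>The colours lost to neighbours of the same type among the roots.\<close>
    define K where "K e a w = (if tt (colour_class a) w = i then (\<lambda>t. f\<^sub>0 (b e (a, w, t))) ` {..<m a} else {})"
      for e a w
    have "\<exists>f. e \<in> H \<longrightarrow> a \<in> A \<longrightarrow> (\<forall>w\<in>V a. f w \<in> M (copy e a w) - K e a w) \<and>
      (\<forall>u w. {u, w} \<in> E a \<longrightarrow> tt (colour_class a) u = tt (colour_class a) w \<longrightarrow> f u \<noteq> f w)" for e a
    proof (cases "e \<in> H \<and> a \<in> A")
      case True
      then have aA: "a \<in> A" by blast
      have Mc: "finite (M (copy e a w))"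
        "ns ! tt (colour_class a) w - load ms D \<phi> (tt (colour_class a) w) \<le> card (M (copy e a w))"
        if "w \<in> V a" for w
      proof -
        have "copy e a w \<in> vertices" using True that by (auto simp: vertices_def)
        then show "finite (M (copy e a w))"
          "ns ! tt (colour_class a) w - load ms D \<phi> (tt (colour_class a) w) \<le> card (M (copy e a w))"
          using M ty_copy[of e a w] True by auto
      qed
      have "\<forall>w\<in>V a. finite (M (copy e a w) - K e a w) \<and>
          ns ! tt (colour_class a) w - load ms (insert (colour_class a) D) (\<phi>(colour_class a := i)) (tt (colour_class a) w)
            \<le> card (M (copy e a w) - K e a w)"
      proof (intro ballI conjI)
        fix w assume w: "w \<in> V a"
        show "finite (M (copy e a w) - K e a w)" using Mc(1)[OF w] by simp
        show "ns ! tt (colour_class a) w - load ms (insert (colour_class a) D) (\<phi>(colour_class a := i)) (tt (colour_class a) w)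
            \<le> card (M (copy e a w) - K e a w)"
        proof -
          have fK: "finite (K e a w)" by (simp add: K_def)
          have "card (K e a w) \<le> (if tt (colour_class a) w = i then ms ! colour_class a else 0)"
            using card_image_le[of "{..<m a}" "\<lambda>t. f\<^sub>0 (b e (a, w, t))"] by (simp add: K_def m_def)
          moreover have "card (M (copy e a w)) - card (K e a w) \<le> card (M (copy e a w) - K e a w)"
            by (rule diff_card_le_card_Diff[OF fK])
          moreover have "load ms (insert (colour_class a) D) (\<phi>(colour_class a := i)) (tt (colour_class a) w) =
              load ms D \<phi> (tt (colour_class a) w) + (if tt (colour_class a) w = i then ms ! colour_class a else 0)"
            using load_insert[OF \<open>finite D\<close>] clsA True by blast
          ultimately show ?thesis using Mc(2)[OF w] by linarith
        qed
      qed
      then have "\<exists>f. (\<forall>w\<in>V a. f w \<in> M (copy e a w) - K e a w) \<and>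
          (\<forall>u w. {u, w} \<in> E a \<longrightarrow> tt (colour_class a) u = tt (colour_class a) w \<longrightarrow> f u \<noteq> f w)"
        by (rule choos[OF aA, unfolded typed_choosable_def,
              THEN spec[of _ "\<lambda>w. M (copy e a w) - K e a w"], THEN mp])
      then show ?thesis by blast
    qed blast
    then obtain g where
      g: "\<And>e a w. e \<in> H \<Longrightarrow> a \<in> A \<Longrightarrow> w \<in> V a \<Longrightarrow> g e a w \<in> M (copy e a w) - K e a w" and
      gE: "\<And>e a u w. e \<in> H \<Longrightarrow> a \<in> A \<Longrightarrow> {u, w} \<in> E a \<Longrightarrow> tt (colour_class a) u = tt (colour_class a) w \<Longrightarrow>
             g e a u \<noteq> g e a w" by metis
    define f where "f = attachment_case f\<^sub>0 g"
    have f_root: "f (root x) = f\<^sub>0 x" for x by (simp add: f_def)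
    have f_copy: "f (copy e a w) = g e a w" if "e \<in> H" for e a w
      using finite_edge[OF that] by (simp add: f_def)
    have pegs: "f (root (b e (a, w, t))) \<noteq> f (copy e a w)"
      if asm: "e \<in> H" "a \<in> A" "w \<in> V a" "t < m a" "i = tt (colour_class a) w" for e a w t
    proof -
      have "f\<^sub>0 (b e (a, w, t)) \<in> K e a w" using asm(4,5) by (simp add: K_def)
      then show ?thesis using g[OF asm(1-3)] f_root f_copy[OF asm(1)] by auto
    qed
    have "f v \<in> M v" if v: "v \<in> vertices" for v
    proof -
      from v consider (root) x where "x \<in> \<Union>H" "v = root x"
        | (copy) e a w where "e \<in> H" "a \<in> A" "w \<in> V a" "v = copy e a w"
        unfolding vertices_def by blast
      then show ?thesis
      proof cases
        case root
        then show ?thesis using f0[OF root(1)] by (simp add: f_root)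
      next
        case copy
        then show ?thesis using g[OF copy(1-3)] by (simp add: f_copy)
      qed
    qed
    moreover have "f u \<noteq> f v" if "{u, v} \<in> edges" "ty u = ty v" for u v
      using that(1)
    proof (cases rule: edge_cases)
      case (inner e a x w)
      then show ?thesis using gE[OF inner(1-3)] that(2) by (simp add: f_copy ty_copy)
    next
      case (peg e a w t)
      then show ?thesis using pegs[OF peg(1-4)] that(2) by (simp add: ty_copy ty_root)
    next
      case (peg' e a w t)
      then show ?thesis using pegs[OF peg'(1-4)] that(2) by (simp add: ty_copy ty_root)
    qed
    ultimately show "\<exists>f. (\<forall>v\<in>vertices. f v \<in> M v) \<and>
        (\<forall>u v. {u, v} \<in> edges \<longrightarrow> ty u = ty v \<longrightarrow> f u \<noteq> f v)" by blast
  qed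
  moreover have "class_lists vertices ms ?J L"
    unfolding class_lists_def
  proof
    fix v assume "v \<in> vertices"
    then consider (root) x where "v = root x"
      | (copy) e a w where "e \<in> H" "a \<in> A" "w \<in> V a" "v = copy e a w"
      unfolding vertices_def by blast
    then show "finite (L v) \<and> colour_class ` L v \<subseteq> ?J \<and> (\<forall>j\<in>?J. card {c \<in> L v. colour_class c = j} = ms ! j)"
    proof cases
      case root
      have "{c \<in> L v. colour_class c = j} = (\<lambda>a. col a x) ` {a \<in> A. colour_class a = j}" for j
        by (auto simp: root L_root)
      then have "card {c \<in> L v. colour_class c = j} = card {a \<in> A. colour_class a = j}" for j
        by (simp add: card_image inj_on_def)
      then show ?thesis using \<open>finite A\<close> clsA cardA by (auto simp: root L_root)
    next
      case copy
      have "card {c \<in> L v. colour_class c = j} = ms ! j" if j: "j \<in> ?J" for j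
      proof (cases "j = colour_class a")
        case True
        have "{c \<in> L v. colour_class c = j} = (\<lambda>t. col a (b e (a, w, t))) ` {..<m a}"
          using Lcls[OF copy(2,3)] by (auto simp: copy(4) L_copy[OF copy(1)] True)
        moreover have "inj_on (\<lambda>t. col a (b e (a, w, t))) {..<m a}"
          using b_eq_iff[OF copy(1-3) _ copy(2,3)] by (auto simp: inj_on_def)
        ultimately show ?thesis by (simp add: card_image m_def True)
      next
        case False
        then have "{c \<in> L v. colour_class c = j} = {c \<in> LL (colour_class a) w. colour_class c = j}"
          by (auto simp: copy(4) L_copy[OF copy(1)])
        then show ?thesis using Lcard[OF copy(2,3) j False] by simp
      qed
      then show ?thesis
        using Lfin[OF copy(2,3)] Lcls[OF copy(2,3)] clsA[OF copy(2)]
        by (auto simp: copy(4) L_copy[OF copy(1)])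
    qed
  qed
  moreover have "\<not> list_colourable vertices edges L"
  proof
    assume "list_colourable vertices edges L"
    then obtain f where f: "\<And>v. v \<in> vertices \<Longrightarrow> f v \<in> L v"
      and proper: "\<And>u v. {u, v} \<in> edges \<Longrightarrow> f u \<noteq> f v"
      unfolding list_colourable_def by blast
    have "\<exists>a. x \<in> \<Union>H \<longrightarrow> a \<in> A \<and> f (root x) = col a x" for x
      using f[of "root x"] by (auto simp: vertices_def L_root)
    then obtain c where c: "\<And>x. x \<in> \<Union>H \<Longrightarrow> c x \<in> A \<and> f (root x) = col (c x) x" by metis
    \<comment> \<open>Outside the vertices of \<open>H\<close> an arbitrary slot serves as default.\<close>
    define c' where "c' x = (if x \<in> \<Union>H then c x else prod_encode (j0, 0))" for x
    have "\<forall>x. c' x < r" using c a0 r by (simp add: c'_def)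
    then obtain e a where e: "e \<in> H" "\<And>x. x \<in> e \<Longrightarrow> c' x = a"
      using H(3) unfolding unavoidable_def by blast
    have ca: "c x = a" if "x \<in> e" for x
    proof -
      have "x \<in> \<Union>H" using e(1) that by blast
      then have "c' x = c x" unfolding c'_def by (rule if_P)
      then show ?thesis using e(2)[OF that] by simp
    qed
    obtain x0 where "x0 \<in> e" using H_ne[OF e(1)] by blast
    then have a: "a \<in> A" using c[of x0] ca e(1) by blast
    have "f (copy e a w) \<in> LL (colour_class a) w" if w: "w \<in> V a" for w
    proof -
      have "copy e a w \<in> vertices" using e(1) a w by (auto simp: vertices_def)
      then have "f (copy e a w) \<in> LL (colour_class a) w \<union> (\<lambda>t. col a (b e (a, w, t))) ` {..<m a}"
        using f L_copy[OF e(1)] by metis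
      moreover have "f (copy e a w) \<noteq> col a (b e (a, w, t))" if t: "t < m a" for t
      proof -
        have be: "b e (a, w, t) \<in> e" using b_in[OF e(1) a w t] .
        have "f (root (b e (a, w, t))) = col a (b e (a, w, t))"
          using c[of "b e (a, w, t)"] ca[OF be] be e(1) by auto
        moreover have "{root (b e (a, w, t)), copy e a w} \<in> edges"
          by (rule peg_in_edges[OF e(1) a w t])
        ultimately show ?thesis using proper by metis
      qed
      ultimately show ?thesis by blast
    qed
    moreover have "f (copy e a u) \<noteq> f (copy e a w)" if "{u, w} \<in> E a" for u w
    proof -
      have "{copy e a u, copy e a w} \<in> edges"
        by (rule inner_in_edges[OF e(1) a that])
      then show ?thesis using proper by blast
    qed
    ultimately have "list_colourable (V a) (E a) (LL (colour_class a))"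
      unfolding list_colourable_def by (intro exI[of _ "\<lambda>w. f (copy e a w)"]) blast
    then show False using bad[OF a] by blast
  qed
  moreover have "ty v < length ns" if "v \<in> vertices" for v
  proof -
    from that consider (root) x where "v = root x"
      | (copy) e a w where "e \<in> H" "a \<in> A" "w \<in> V a" "v = copy e a w"
      unfolding vertices_def by blast
    then show ?thesis by cases (use i(1) ttV ty_root ty_copy in auto)
  qed
  then have "ty ` vertices \<subseteq> {..<length ns}" by auto
  ultimately have "gadget (Suc h) ns ms D \<phi> vertices edges ty L"
    unfolding gadget_def
    using simple_graph_attachment sparse_attachment[OF H(2) spE] by blast
  then show ?thesis by blast
qed

text \<open>Classes are assigned to types one after the other; the type that receives the next class is one
  whose load is still too small. There always is one, even when the classes outside \<open>D\<close> are counted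
  with their provisional values under \<open>\<phi>\<close>. When every class has been assigned, a
  single vertex of such a type, with the empty list, is a gadget.\<close>
lemma gadget_exists:
  assumes pos: "\<And>j. j < length ms \<Longrightarrow> 0 < ms ! j"
    and short: "\<And>\<phi>. (\<And>j. j < length ms \<Longrightarrow> \<phi> j < length ns) \<Longrightarrow>
                  \<exists>i<length ns. load ms {..<length ms} \<phi> i < ns ! i"
    and "D \<subseteq> {..<length ms}" and "\<And>j. j < length ms \<Longrightarrow> \<phi> j < length ns"
  shows "\<exists>V E ty L. gadget (Suc h) ns ms D \<phi> V E ty L"
  using assms(3,4)
proof (induction "card ({..<length ms} - D)" arbitrary: D \<phi> rule: less_induct)
  case less
  obtain i where i: "i < length ns" "load ms {..<length ms} \<phi> i < ns ! i"
    using short less.prems(2) by blast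
  show ?case
  proof (cases "D = {..<length ms}")
    case True
    have "gadget (Suc h) ns ms D \<phi> {0} {} (\<lambda>_. i) (\<lambda>_. {})"
      unfolding gadget_def typed_choosable_def
    proof (intro conjI allI impI)
      fix M :: "nat \<Rightarrow> nat set"
      assume "\<forall>v\<in>{0}. finite (M v) \<and> ns ! i - load ms D \<phi> i \<le> card (M v)"
      then have "card (M 0) \<noteq> 0" using i True by auto
      then obtain c where "c \<in> M 0" by (auto simp: card_eq_0_iff)
      then show "\<exists>f. (\<forall>v\<in>{0}. f v \<in> M v) \<and> (\<forall>u v. {u, v} \<in> {} \<longrightarrow> i = i \<longrightarrow> f u \<noteq> f v)"
        by (intro exI[of _ "\<lambda>_. c"]) simp
    qed (use i True in \<open>auto simp: simple_graph_def sparse_def class_lists_def list_colourable_def\<close>)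
    then show ?thesis by blast
  next
    case False
    have "load ms D \<phi> i \<le> load ms {..<length ms} \<phi> i"
      unfolding load_def using less.prems(1) by (intro sum_mono2) auto
    then have load: "load ms D \<phi> i < ns ! i" using i(2) by simp
    show ?thesis
    proof (rule gadget_step[OF _ pos i(1) load])
      show "D \<subset> {..<length ms}" using False less.prems(1) by blast
      fix j assume j: "j < length ms" "j \<notin> D"
      show "\<exists>V E ty L. gadget (Suc h) ns ms (insert j D) (\<phi>(j := i)) V E ty L"
      proof (rule less.hyps)
        show "card ({..<length ms} - insert j D) < card ({..<length ms} - D)"
          using j by (intro psubset_card_mono) auto
      qed (use j less.prems i(1) in auto)
    qed
  qed
qed

section \<open>From gadgets to the separation of partitions\<close>

lemma mset_eq_sum_nth: "mset xs = (\<Sum>j<length xs. {#xs ! j#})"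
  by (induction xs rule: rev_induct) (simp_all add: nth_append)

text \<open>If the parts of \<open>ms\<close> can be distributed to the parts of \<open>ns\<close> so that each of the latter receives
  at least its own size, the sums received are the coarser partition required by the definition of
  the order.\<close>
lemma partition_le_if_loads_suffice:
  fixes ns ms :: "nat list"
  assumes ns: "\<And>i. i < length ns \<Longrightarrow> 0 < ns ! i" and ms: "\<And>j. j < length ms \<Longrightarrow> 0 < ms ! j"
    and pos: "0 < sum_list ms" and \<phi>: "\<And>j. j < length ms \<Longrightarrow> \<phi> j < length ns"
    and load: "\<And>i. i < length ns \<Longrightarrow> ns ! i \<le> load ms {..<length ms} \<phi> i"
  shows "partition_le (mset ns) (mset ms)"
proof -
  let ?p = "length ms" and ?q = "length ns"
  let ?load = "load ms {..<?p} \<phi>"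
  define part where "part i = (\<Sum>j\<in>{j\<in>{..<?p}. \<phi> j = i}. {#ms ! j#})" for i
  have sum_part: "\<Sum>\<^sub># (\<Sum>j\<in>S. {#ms ! j#}) = (\<Sum>j\<in>S. ms ! j)"
    and in_part: "x \<in># (\<Sum>j\<in>S. {#ms ! j#}) \<longleftrightarrow> x \<in> (!) ms ` S" if "finite S" for S x
    using that by (induction S rule: finite_induct) auto
  have group: "(\<Sum>i<?q. sum h {j\<in>{..<?p}. \<phi> j = i}) = sum h {..<?p}"
    for h :: "nat \<Rightarrow> 'b::comm_monoid_add"
    using \<phi> by (intro sum.group) auto
  have total: "(\<Sum>i<?q. ?load i) = sum_list ms"
    unfolding load_def group by (simp add: sum_list_sum_nth atLeast0LessThan)
  let ?xs = "map ?load [0..<?q]"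
  have sum_xs: "sum_list ?xs = sum_list ms"
    using total by (simp add: interv_sum_list_conv_sum_set_nat atLeast0LessThan)
  have "sum_list ns = (\<Sum>i<?q. ns ! i)" by (simp add: sum_list_sum_nth atLeast0LessThan)
  also have "\<dots> \<le> (\<Sum>i<?q. ?load i)" using load by (intro sum_mono) simp
  finally have "sum_list ns \<le> sum_list ms" using total by simp
  moreover have "partition_of (mset ?xs) (sum_list ms)"
  proof -
    have "?load i \<noteq> 0" if "i < ?q" for i using load[OF that] ns[OF that] by simp
    then have "0 \<notin># mset ?xs" unfolding set_mset_mset by force
    then show ?thesis using sum_xs pos unfolding partition_of_def sum_mset_sum_list by blast
  qed
  moreover have "rel_mset (\<le>) (mset ns) (mset ?xs)"
    unfolding rel_mset_def using load
    by (intro exI[of _ ns] exI[of _ ?xs]) (simp add: list_all2_conv_all_nth)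
  moreover have "refinement (mset ms) (mset ?xs)"
    unfolding refinement_def
  proof (intro exI[of _ "mset (map part [0..<?q])"] conjI)
    have "partition_of (part i) (?load i)" if "i < ?q" for i
    proof -
      have "0 \<notin># part i" using ms in_part by (force simp: part_def)
      moreover have "\<Sum>\<^sub># (part i) = ?load i" by (simp add: part_def sum_part load_def)
      moreover have "0 < ?load i" using load[OF that] ns[OF that] by simp
      ultimately show ?thesis by (simp add: partition_of_def)
    qed
    then show "rel_mset partition_of (mset (map part [0..<?q])) (mset ?xs)"
      unfolding rel_mset_def
      by (intro exI[of _ "map part [0..<?q]"] exI[of _ ?xs]) (simp add: list_all2_conv_all_nth)
    have "\<Sum>\<^sub># (mset (map part [0..<?q])) = (\<Sum>i<?q. part i)"
      by (simp only: sum_mset_sum_list interv_sum_list_conv_sum_set_nat atLeast0LessThan set_upt)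
    then show "mset ms = \<Sum>\<^sub># (mset (map part [0..<?q]))"
      unfolding part_def group mset_eq_sum_nth[of ms] by simp
  qed
  ultimately show ?thesis unfolding partition_le_def sum_mset_sum_list by blast
qed

text \<open>Colour the vertices of type \<open>i\<close> from the \<open>i\<close>-th colour class only. Classes are disjoint, so
  edges between different types take care of themselves. The classes of the assignment may come in
  another order than the parts in \<open>ns\<close>, whence the bijection \<open>\<pi>\<close>.\<close>
lemma choosable_if_typed_choosable:
  assumes E: "\<And>e. e \<in> E \<Longrightarrow> e \<subseteq> V" and ty: "ty ` V \<subseteq> {..<length ns}"
    and ch: "typed_choosable V E ty (\<lambda>i. ns ! i)"
  shows "choosable V E (mset ns)"
  unfolding choosable_def
proof (intro allI impI)
  fix L :: "nat \<Rightarrow> nat set"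
  assume L: "partition_assignment V (mset ns) L"
  then obtain ks C where ks: "mset ks = mset ns" and disj: "disjoint_family_on C {..<length ks}"
    and cards: "\<forall>v\<in>V. \<forall>i<length ks. card (L v \<inter> C i) = ks ! i"
    unfolding partition_assignment_def by (elim conjE exE)
  have fin: "\<forall>v\<in>V. finite (L v)"
    using L by (simp add: partition_assignment_def k_assignment_def)
  obtain \<pi> where \<pi>: "bij_betw \<pi> {..<length ns} {..<length ks}" "\<forall>i<length ns. ns ! i = ks ! \<pi> i"
    using permutation_Ex_bij[OF ks[symmetric]] by blast
  define M where "M v = L v \<inter> C (\<pi> (ty v))" for v
  have ty': "\<pi> (ty v) < length ks" "ns ! ty v = ks ! \<pi> (ty v)" if "v \<in> V" for v
    using that ty \<pi> by (auto simp: bij_betw_def)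
  have "\<forall>v\<in>V. finite (M v) \<and> ns ! ty v \<le> card (M v)"
    using fin cards ty' by (auto simp: M_def)
  then obtain f where f: "\<forall>v\<in>V. f v \<in> M v"
    and proper: "\<forall>u v. {u, v} \<in> E \<longrightarrow> ty u = ty v \<longrightarrow> f u \<noteq> f v"
    using ch unfolding typed_choosable_def by blast
  have "f u \<noteq> f v" if uv: "{u, v} \<in> E" for u v
  proof (cases "ty u = ty v")
    case False
    have V: "u \<in> V" "v \<in> V" using E[OF uv] by auto
    then have "ty u < length ns" "ty v < length ns" using ty by auto
    then have "\<pi> (ty u) \<noteq> \<pi> (ty v)" using \<pi>(1) False by (auto simp: bij_betw_def dest: inj_onD)
    then have "C (\<pi> (ty u)) \<inter> C (\<pi> (ty v)) = {}"
      using disj ty'(1) V by (simp add: disjoint_family_on_def)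
    moreover have "f u \<in> C (\<pi> (ty u))" "f v \<in> C (\<pi> (ty v))" using f V by (auto simp: M_def)
    ultimately show ?thesis by auto
  qed (use proper uv in blast)
  then show "list_colourable V E L"
    unfolding list_colourable_def using f by (intro exI[of _ f]) (auto simp: M_def)
qed

lemma partition_assignment_if_class_lists:
  assumes "class_lists V ms {..<length ms} L"
  shows "partition_assignment V (mset ms) L"
proof -
  define C where "C i = {c \<in> \<Union>v\<in>V. L v. colour_class c = i}" for i
  have L: "finite (L v)" "colour_class ` L v \<subseteq> {..<length ms}"
    "\<And>j. j < length ms \<Longrightarrow> card {c \<in> L v. colour_class c = j} = ms ! j" if "v \<in> V" for v
    using assms that by (simp_all add: class_lists_def)
  have "card (L v) = sum_list ms" if v: "v \<in> V" for v
  proof -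
    have "card (L v) = (\<Sum>j<length ms. card {c \<in> L v. colour_class c = j})"
      using sum.group[OF L(1)[OF v] _ L(2)[OF v], of "\<lambda>_. 1::nat"] by simp
    also have "\<dots> = sum_list ms"
      using L(3)[OF v] by (simp add: sum_list_sum_nth atLeast0LessThan)
    finally show ?thesis .
  qed
  then have "k_assignment V (\<Sum>\<^sub># (mset ms)) L"
    using L(1) by (simp add: k_assignment_def sum_mset_sum_list)
  moreover have "disjoint_family_on C {..<length ms}"
    by (auto simp: disjoint_family_on_def C_def)
  moreover have "(\<Union>i<length ms. C i) = (\<Union>v\<in>V. L v)"
    using L(2) by (fastforce simp: C_def)
  moreover have "card (L v \<inter> C i) = ms ! i" if "v \<in> V" "i < length ms" for v i
  proof -
    have "L v \<inter> C i = {c \<in> L v. colour_class c = i}" using that(1) by (auto simp: C_def)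
    then show ?thesis using L(3) that by simp
  qed
  ultimately show ?thesis
    unfolding partition_assignment_def
    by (intro conjI exI[of _ ms] exI[of _ C] ballI allI impI) simp_all
qed

theorem theorem2:
  fixes g k k' :: nat and l l' :: "nat multiset"
  assumes "g > 0" and "partition_of l k" and "partition_of l' k'" and "\<not> partition_le l l'"
  shows "\<exists>(V :: nat set) E. simple_graph V E \<and> enat g \<le> girth V E \<and>
           choosable V E l \<and> \<not> choosable V E l'"
proof -
  obtain ns ms where l: "l = mset ns" and l': "l' = mset ms"
    using ex_mset[of l] ex_mset[of l'] by metis
  have ns: "0 < ns ! i" if "i < length ns" for i
    using assms(2) that nth_mem[OF that] unfolding l partition_of_def by (metis gr0I set_mset_mset)
  have ms: "0 < ms ! j" if "j < length ms" for j
    using assms(3) that nth_mem[OF that] unfolding l' partition_of_def by (metis gr0I set_mset_mset)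
  have "0 < sum_list ns" "0 < sum_list ms"
    using assms(2,3) unfolding l l' partition_of_def sum_mset_sum_list by auto
  then have "0 < length ns" by (cases ns) auto
  have short: "\<exists>i<length ns. load ms {..<length ms} \<phi> i < ns ! i"
    if "\<And>j. j < length ms \<Longrightarrow> \<phi> j < length ns" for \<phi>
  proof (rule ccontr)
    assume "\<not> ?thesis"
    then have "ns ! i \<le> load ms {..<length ms} \<phi> i" if "i < length ns" for i
      using that by (meson not_less)
    then have "partition_le (mset ns) (mset ms)"
      using partition_le_if_loads_suffice[OF ns ms \<open>0 < sum_list ms\<close>, of \<phi>] that by blast
    then show False using assms(4) l l' by simp
  qed
  obtain V E ty L where gadget: "gadget (Suc g) ns ms {} (\<lambda>_. 0) V E ty L"
    using gadget_exists[OF ms short, of "{}" "\<lambda>_. 0" g] \<open>0 < length ns\<close> by auto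
  then have G: "simple_graph V E" "sparse (Suc g) E" "ty ` V \<subseteq> {..<length ns}"
    "typed_choosable V E ty (\<lambda>i. ns ! i)" "class_lists V ms {..<length ms} L"
    "\<not> list_colourable V E L"
    by (simp_all add: gadget_def load_def)
  have "enat g \<le> girth V E" by (rule girth_ge_if_sparse[OF G(2)]) simp
  moreover have "choosable V E l"
    unfolding l using G(1) by (intro choosable_if_typed_choosable[OF _ G(3,4)]) (simp add: simple_graph_def)
  moreover have "\<not> choosable V E l'"
    unfolding l' choosable_def using partition_assignment_if_class_lists[OF G(5)] G(6) by blast
  ultimately show ?thesis using G(1) by blast
qed

end
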